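(* Let $A$ be a commutative ring with nonzero identity, let $M$ be a multiplication $A$-module and $P$ a proper submodule of $M$. The following statements are equivalent. (i) $P$ is a 1-absorbing prime submodule of $M$. (ii) $P$ is a classical 1-absorbing prime submodule of $M$. (iii) $(P:_{A}M)$ is a 1-absorbing prime ideal of $A$.
   Context: All rings are commutative with nonzero identity; the given module $M$ is nonzero and unital. An $A$-module $M$ is a multiplication module if every submodule of $M$ has the form $IM$ for some ideal $I$ of $A$. For a submodule $P$ of $M$, $(P:_{A}M)=\{a\in A: aM\subseteq P\}$. A proper submodule $P$ of $M$ is a 1-absorbing prime submodule if whenever $abcm\in P$ for nonunits $a,b,c\in A$ and $m\in M$, then $ab\in(P:_{A}M)$ or $cm\in P$. A proper submodule $P$ of $M$ is a classical 1-absorbing prime submodule if whenever $abcm\in P$ for nonunits $a,b,c\in A$ and $m\in M$, then $abm\in P$ or $cm\in P$. A proper ideal $I$ of $A$ is a 1-absorbing prime ideal if whenever $abc\in I$ for nonunits $a,b,c\in A$, then $ab\in I$ or $c\in I$. *)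

theory Defs
  imports "HOL-Algebra.Algebra"
begin

(* IM. For an ideal I the set of products a m is closed under negation, so the additive
   subgroup it generates consists exactly of the finite sums of such products. *)
definition ideal_smult ::
    "('a, 'b, 'n) module_scheme \<Rightarrow> 'a set \<Rightarrow> 'b set" where
  "ideal_smult M I =
     generate (add_monoid M) {a \<odot>\<^bsub>M\<^esub> m | a m. a \<in> I \<and> m \<in> carrier M}"

definition multiplication_module ::
    "('a, 'm) ring_scheme \<Rightarrow> ('a, 'b, 'n) module_scheme \<Rightarrow> bool" where
  "multiplication_module A M \<longleftrightarrow>
     module A M \<and>
     (\<forall>N. submodule N A M \<longrightarrow> (\<exists>I. ideal I A \<and> N = ideal_smult M I))"

definition residual ::
    "('a, 'm) ring_scheme \<Rightarrow> ('a, 'b, 'n) module_scheme \<Rightarrow> 'b set \<Rightarrow> 'a set" where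
  "residual A M P = {a \<in> carrier A. \<forall>m \<in> carrier M. a \<odot>\<^bsub>M\<^esub> m \<in> P}"

definition nonunits :: "('a, 'm) ring_scheme \<Rightarrow> 'a set" where
  "nonunits A = carrier A - Units A"

definition one_absorbing_prime_submodule ::
    "('a, 'm) ring_scheme \<Rightarrow> ('a, 'b, 'n) module_scheme \<Rightarrow> 'b set \<Rightarrow> bool" where
  "one_absorbing_prime_submodule A M P \<longleftrightarrow>
     submodule P A M \<and> P \<noteq> carrier M \<and>
     (\<forall>a \<in> nonunits A. \<forall>b \<in> nonunits A. \<forall>c \<in> nonunits A. \<forall>m \<in> carrier M.
        (a \<otimes>\<^bsub>A\<^esub> b \<otimes>\<^bsub>A\<^esub> c) \<odot>\<^bsub>M\<^esub> m \<in> P \<longrightarrow>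
        a \<otimes>\<^bsub>A\<^esub> b \<in> residual A M P \<or> c \<odot>\<^bsub>M\<^esub> m \<in> P)"

definition classical_one_absorbing_prime_submodule ::
    "('a, 'm) ring_scheme \<Rightarrow> ('a, 'b, 'n) module_scheme \<Rightarrow> 'b set \<Rightarrow> bool" where
  "classical_one_absorbing_prime_submodule A M P \<longleftrightarrow>
     submodule P A M \<and> P \<noteq> carrier M \<and>
     (\<forall>a \<in> nonunits A. \<forall>b \<in> nonunits A. \<forall>c \<in> nonunits A. \<forall>m \<in> carrier M.
        (a \<otimes>\<^bsub>A\<^esub> b \<otimes>\<^bsub>A\<^esub> c) \<odot>\<^bsub>M\<^esub> m \<in> P \<longrightarrow>
        (a \<otimes>\<^bsub>A\<^esub> b) \<odot>\<^bsub>M\<^esub> m \<in> P \<or> c \<odot>\<^bsub>M\<^esub> m \<in> P)"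

definition one_absorbing_prime_ideal ::
    "('a, 'm) ring_scheme \<Rightarrow> 'a set \<Rightarrow> bool" where
  "one_absorbing_prime_ideal A I \<longleftrightarrow>
     ideal I A \<and> I \<noteq> carrier A \<and>
     (\<forall>a \<in> nonunits A. \<forall>b \<in> nonunits A. \<forall>c \<in> nonunits A.
        a \<otimes>\<^bsub>A\<^esub> b \<otimes>\<^bsub>A\<^esub> c \<in> I \<longrightarrow> a \<otimes>\<^bsub>A\<^esub> b \<in> I \<or> c \<in> I)"

end

theory Submission
  imports Defs
begin

text \<open>
  Write \<open>(P : M)\<close> for the residual ideal and, for a scalar \<open>r\<close>, \<open>(P : r)\<close> for the submodule of
  all \<open>x\<close> with \<open>r x \<in> P\<close>.  Thus \<open>r \<in> (P : M)\<close> means that \<open>(P : r)\<close> is all of \<open>M\<close>.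

  From (i) to (ii) one specialises \<open>a b \<in> (P : M)\<close> to the given \<open>m\<close>.

  From (ii) to (iii), let \<open>a b c \<in> (P : M)\<close> with \<open>a, b, c\<close> nonunits.  Then (ii), applied to each
  \<open>m\<close>, says that \<open>M\<close> is the union of \<open>(P : a b)\<close> and \<open>(P : c)\<close>.  The choice between the two
  alternatives may depend on \<open>m\<close>, but a group is never the union of two proper subgroups, so one
  alternative holds for all \<open>m\<close> simultaneously.

  From (iii) to (i), let \<open>a b c m \<in> P\<close> and \<open>a b \<notin> (P : M)\<close>.  Since \<open>M\<close> is a multiplication
  module, \<open>A m = I M\<close> for some ideal \<open>I\<close>, and \<open>a b c\<close> sends \<open>A m\<close> into \<open>P\<close>.  Hence
  \<open>a b (c i) \<in> (P : M)\<close> for every \<open>i \<in> I\<close>.  The product \<open>c i\<close> is again a nonunit, so (iii) gives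
  \<open>c i \<in> (P : M)\<close>.  Therefore \<open>c\<close> sends \<open>I M = A m\<close> into \<open>P\<close>, and in particular \<open>c m \<in> P\<close>.
\<close>

lemma nonunits_carrier: "a \<in> nonunits A \<Longrightarrow> a \<in> carrier A"
  by (simp add: nonunits_def)

lemma (in cring) nonunit_mult:
  assumes "c \<in> nonunits R" "i \<in> carrier R"
  shows "c \<otimes> i \<in> nonunits R"
  using assms unit_factor[of c i] by (auto simp: nonunits_def)

text \<open>
  If \<open>h\<close> lay outside \<open>K\<close> and \<open>k\<close> outside \<open>H\<close>, the product \<open>h k\<close> could lie in neither
  subgroup, since cancelling the factor in that subgroup would put the other factor there too.
\<close>

lemma (in group) subgroup_cover_two:
  assumes H: "subgroup H G" and K: "subgroup K G" and cover: "carrier G \<subseteq> H \<union> K"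
  shows "H = carrier G \<or> K = carrier G"
proof (rule ccontr)
  assume "\<not> ?thesis"
  then obtain h k where h: "h \<in> carrier G" "h \<notin> K" and k: "k \<in> carrier G" "k \<notin> H"
    using subgroup.subset[OF H] subgroup.subset[OF K] by blast
  have hH: "h \<in> H" and kK: "k \<in> K"
    using h k cover by auto
  have "h \<otimes> k \<in> H \<union> K"
    using cover h(1) k(1) by blast
  then show False
  proof
    assume "h \<otimes> k \<in> H"
    then have "inv h \<otimes> (h \<otimes> k) \<in> H"
      using H hH by (simp add: subgroup.m_closed subgroup.m_inv_closed)
    then show False
      using h(1) k by (simp flip: m_assoc)
  next
    assume "h \<otimes> k \<in> K"
    then have "(h \<otimes> k) \<otimes> inv k \<in> K"
      using K kK by (simp add: subgroup.m_closed subgroup.m_inv_closed)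
    then show False
      using h k(1) by (simp add: m_assoc)
  qed
qed

context module
begin

lemma submodule_zero: "submodule P R M \<Longrightarrow> \<zero>\<^bsub>M\<^esub> \<in> P"
  using subgroup.one_closed[of P "add_monoid M"] submodule.axioms(1) by fastforce

definition scalar_preimage :: "'c set \<Rightarrow> 'a \<Rightarrow> 'c set" where
  "scalar_preimage P r = {x \<in> carrier M. r \<odot>\<^bsub>M\<^esub> x \<in> P}"

lemma scalar_preimage_submodule:
  assumes P: "submodule P R M" and r: "r \<in> carrier R"
  shows "submodule (scalar_preimage P r) R M"
proof (rule submoduleI)
  fix s x assume s: "s \<in> carrier R" and x: "x \<in> scalar_preimage P r"
  have "r \<odot>\<^bsub>M\<^esub> (s \<odot>\<^bsub>M\<^esub> x) = s \<odot>\<^bsub>M\<^esub> (r \<odot>\<^bsub>M\<^esub> x)"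
    using r s x by (simp add: scalar_preimage_def R.m_comm flip: smult_assoc1)
  then show "s \<odot>\<^bsub>M\<^esub> x \<in> scalar_preimage P r"
    using s x submoduleE(4)[OF P] by (simp add: scalar_preimage_def)
qed (use r submodule_zero[OF P] submoduleE[OF P] in
      \<open>auto simp: scalar_preimage_def smult_r_distr smult_r_minus\<close>)

lemma residual_iff_scalar_preimage:
  "r \<in> residual R M P \<longleftrightarrow> r \<in> carrier R \<and> scalar_preimage P r = carrier M"
  by (auto simp: residual_def scalar_preimage_def)

lemma residual_ideal:
  assumes P: "submodule P R M"
  shows "ideal (residual R M P) R"
proof (rule idealI)
  show "subgroup (residual R M P) (add_monoid R)"
    using submodule_zero[OF P] submoduleE[OF P]
    by (intro R.add.subgroupI)
       (auto simp: residual_def smult_l_distr smult_l_minus simp flip: a_inv_def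
             intro!: exI[of _ "\<zero>\<^bsub>R\<^esub>"])
next
  fix a x assume a: "a \<in> residual R M P" and x: "x \<in> carrier R"
  show xa: "x \<otimes>\<^bsub>R\<^esub> a \<in> residual R M P"
    using a x submoduleE(4)[OF P] by (auto simp: residual_def smult_assoc1)
  show "a \<otimes>\<^bsub>R\<^esub> x \<in> residual R M P"
    using xa a x by (simp add: residual_def R.m_comm)
qed (rule R.ring_axioms)

lemma residual_proper:
  assumes P: "submodule P R M" and "P \<noteq> carrier M"
  shows "residual R M P \<noteq> carrier R"
proof
  assume "residual R M P = carrier R"
  then have "\<one>\<^bsub>R\<^esub> \<in> residual R M P" by simp
  then have "carrier M \<subseteq> P" by (auto simp: residual_def)
  then show False using submoduleE(1)[OF P] assms(2) by blast
qed

lemma cyclic_submodule: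
  assumes m: "m \<in> carrier M"
  shows "submodule ((\<lambda>r. r \<odot>\<^bsub>M\<^esub> m) ` carrier R) R M"
proof (rule submoduleI)
  show "\<zero>\<^bsub>M\<^esub> \<in> (\<lambda>r. r \<odot>\<^bsub>M\<^esub> m) ` carrier R"
    using m by (intro image_eqI[of _ _ "\<zero>\<^bsub>R\<^esub>"]) auto
qed (use m in \<open>auto simp flip: smult_l_distr smult_l_minus smult_assoc1\<close>)

lemma ideal_smult_le:
  assumes N: "submodule N R M"
    and gens: "\<And>i x. i \<in> I \<Longrightarrow> x \<in> carrier M \<Longrightarrow> i \<odot>\<^bsub>M\<^esub> x \<in> N"
  shows "ideal_smult M I \<subseteq> N"
  unfolding ideal_smult_def
  by (rule M.add.generate_subgroup_incl[OF _ submodule.axioms(1)[OF N]]) (use gens in auto)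

text \<open>
  The multiplication property trades the element \<open>m\<close> for an ideal \<open>I\<close> with \<open>R m = I M\<close>:
  \<open>r m \<in> P\<close> holds exactly when \<open>r\<close> sends \<open>R m\<close> into \<open>P\<close>, that is, when \<open>r i M\<close> lies in \<open>P\<close>
  for all \<open>i \<in> I\<close>.  A question about \<open>m\<close> thus becomes one about \<open>(P : M)\<close>, where a hypothesis
  on that ideal applies.  One \<open>I\<close> serves all scalars \<open>r\<close>, so it can be used for \<open>a b c\<close> and then
  for \<open>c\<close>.
\<close>

lemma multiplication_module_smult_mem:
  assumes mult: "multiplication_module R M" and m: "m \<in> carrier M"
  obtains I where "ideal I R"
    and "\<And>P r. submodule P R M \<Longrightarrow> r \<in> carrier R \<Longrightarrow>
           r \<odot>\<^bsub>M\<^esub> m \<in> P \<longleftrightarrow> (\<forall>i\<in>I. r \<otimes>\<^bsub>R\<^esub> i \<in> residual R M P)"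
proof -
  let ?C = "(\<lambda>r. r \<odot>\<^bsub>M\<^esub> m) ` carrier R"
  obtain I where I: "ideal I R" and C: "?C = ideal_smult M I"
    using mult cyclic_submodule[OF m] by (auto simp: multiplication_module_def)
  have I_carrier: "i \<in> carrier R" if "i \<in> I" for i
    using ideal.Icarr[OF I that] .
  have "r \<odot>\<^bsub>M\<^esub> m \<in> P \<longleftrightarrow> (\<forall>i\<in>I. r \<otimes>\<^bsub>R\<^esub> i \<in> residual R M P)"
    if P: "submodule P R M" and r: "r \<in> carrier R" for P r
  proof
    assume rm: "r \<odot>\<^bsub>M\<^esub> m \<in> P"
    have "(r \<otimes>\<^bsub>R\<^esub> i) \<odot>\<^bsub>M\<^esub> x \<in> P" if i: "i \<in> I" and x: "x \<in> carrier M" for i x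
    proof -
      have "i \<odot>\<^bsub>M\<^esub> x \<in> ?C"
        unfolding C ideal_smult_def using i x by (auto intro: generate.incl)
      then obtain s where s: "s \<in> carrier R" "i \<odot>\<^bsub>M\<^esub> x = s \<odot>\<^bsub>M\<^esub> m" by auto
      have "(r \<otimes>\<^bsub>R\<^esub> i) \<odot>\<^bsub>M\<^esub> x = r \<odot>\<^bsub>M\<^esub> (s \<odot>\<^bsub>M\<^esub> m)"
        using r x I_carrier[OF i] s(2) by (simp add: smult_assoc1)
      also have "\<dots> = s \<odot>\<^bsub>M\<^esub> (r \<odot>\<^bsub>M\<^esub> m)"
        using r s(1) m by (simp add: R.m_comm flip: smult_assoc1)
      finally show ?thesis using submoduleE(4)[OF P s(1) rm] by simp
    qed
    then show "\<forall>i\<in>I. r \<otimes>\<^bsub>R\<^esub> i \<in> residual R M P"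
      using r I_carrier by (simp add: residual_def)
  next
    assume "\<forall>i\<in>I. r \<otimes>\<^bsub>R\<^esub> i \<in> residual R M P"
    then have "ideal_smult M I \<subseteq> scalar_preimage P r"
      using r I_carrier
      by (intro ideal_smult_le scalar_preimage_submodule P)
         (auto simp: scalar_preimage_def residual_def smult_assoc1)
    moreover have "m \<in> ?C"
      using m by (intro image_eqI[of _ _ "\<one>\<^bsub>R\<^esub>"]) auto
    ultimately show "r \<odot>\<^bsub>M\<^esub> m \<in> P"
      unfolding C by (auto simp: scalar_preimage_def)
  qed
  with I show thesis by (rule that)
qed

lemma one_absorbing_imp_classical:
  assumes "one_absorbing_prime_submodule R M P"
  shows "classical_one_absorbing_prime_submodule R M P"
  using assms
  unfolding one_absorbing_prime_submodule_def classical_one_absorbing_prime_submodule_def residual_def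
  by blast

lemma classical_imp_residual_one_absorbing:
  assumes "classical_one_absorbing_prime_submodule R M P"
  shows "one_absorbing_prime_ideal R (residual R M P)"
proof -
  have P: "submodule P R M" and proper: "P \<noteq> carrier M"
    using assms by (auto simp: classical_one_absorbing_prime_submodule_def)
  have "a \<otimes>\<^bsub>R\<^esub> b \<in> residual R M P \<or> c \<in> residual R M P"
    if abc: "a \<in> nonunits R" "b \<in> nonunits R" "c \<in> nonunits R"
      and res: "a \<otimes>\<^bsub>R\<^esub> b \<otimes>\<^bsub>R\<^esub> c \<in> residual R M P" for a b c
  proof -
    have ab_carrier: "a \<otimes>\<^bsub>R\<^esub> b \<in> carrier R" and c_carrier: "c \<in> carrier R"
      using abc by (simp_all add: nonunits_carrier)
    have "carrier M \<subseteq> scalar_preimage P (a \<otimes>\<^bsub>R\<^esub> b) \<union> scalar_preimage P c"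
      using assms abc res
      unfolding classical_one_absorbing_prime_submodule_def scalar_preimage_def residual_def
      by blast
    then have "scalar_preimage P (a \<otimes>\<^bsub>R\<^esub> b) = carrier M \<or> scalar_preimage P c = carrier M"
      using M.add.subgroup_cover_two
        submodule.axioms(1)[OF scalar_preimage_submodule[OF P ab_carrier]]
        submodule.axioms(1)[OF scalar_preimage_submodule[OF P c_carrier]]
      by simp
    then show ?thesis
      using ab_carrier c_carrier by (simp add: residual_iff_scalar_preimage)
  qed
  then show ?thesis
    using residual_ideal[OF P] residual_proper[OF P proper]
    by (simp add: one_absorbing_prime_ideal_def)
qed

lemma residual_one_absorbing_imp_one_absorbing:
  assumes mult: "multiplication_module R M"
    and P: "submodule P R M" and proper: "P \<noteq> carrier M"
    and res: "one_absorbing_prime_ideal R (residual R M P)"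
  shows "one_absorbing_prime_submodule R M P"
proof -
  have "c \<odot>\<^bsub>M\<^esub> m \<in> P"
    if nab: "a \<otimes>\<^bsub>R\<^esub> b \<notin> residual R M P"
      and abc: "a \<in> nonunits R" "b \<in> nonunits R" "c \<in> nonunits R"
      and m: "m \<in> carrier M" and abcm: "(a \<otimes>\<^bsub>R\<^esub> b \<otimes>\<^bsub>R\<^esub> c) \<odot>\<^bsub>M\<^esub> m \<in> P" for a b c m
  proof -
    have carriers: "a \<in> carrier R" "b \<in> carrier R" "c \<in> carrier R"
      using abc by (simp_all add: nonunits_carrier)
    obtain I where I: "ideal I R"
      and mem: "\<And>P r. submodule P R M \<Longrightarrow> r \<in> carrier R \<Longrightarrow>
           r \<odot>\<^bsub>M\<^esub> m \<in> P \<longleftrightarrow> (\<forall>i\<in>I. r \<otimes>\<^bsub>R\<^esub> i \<in> residual R M P)"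
      using multiplication_module_smult_mem[OF mult m] by blast
    have "c \<otimes>\<^bsub>R\<^esub> i \<in> residual R M P" if i: "i \<in> I" for i
    proof -
      have i_carrier: "i \<in> carrier R"
        using ideal.Icarr[OF I i] .
      have "a \<otimes>\<^bsub>R\<^esub> b \<otimes>\<^bsub>R\<^esub> c \<otimes>\<^bsub>R\<^esub> i \<in> residual R M P"
        using mem[OF P] abcm i carriers by simp
      then have "a \<otimes>\<^bsub>R\<^esub> b \<otimes>\<^bsub>R\<^esub> (c \<otimes>\<^bsub>R\<^esub> i) \<in> residual R M P"
        using carriers i_carrier by (simp add: R.m_assoc)
      then show ?thesis
        using res nab abc R.nonunit_mult[OF abc(3) i_carrier]
        by (auto simp: one_absorbing_prime_ideal_def)
    qed
    then show "c \<odot>\<^bsub>M\<^esub> m \<in> P"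
      using mem[OF P carriers(3)] by simp
  qed
  then show ?thesis
    using P proper unfolding one_absorbing_prime_submodule_def by blast
qed

end

theorem theorem5:
  fixes A :: "('a, 'm) ring_scheme"
    and M :: "('a, 'b, 'n) module_scheme"
    and P :: "'b set"
  assumes "cring A" and "\<one>\<^bsub>A\<^esub> \<noteq> \<zero>\<^bsub>A\<^esub>"
    and "module A M" and "carrier M \<noteq> {\<zero>\<^bsub>M\<^esub>}"
    and "multiplication_module A M"
    and "submodule P A M" and "P \<noteq> carrier M"
  shows "(one_absorbing_prime_submodule A M P \<longleftrightarrow>
            classical_one_absorbing_prime_submodule A M P) \<and>
         (classical_one_absorbing_prime_submodule A M P \<longleftrightarrow>
            one_absorbing_prime_ideal A (residual A M P))"
proof -
  interpret module A M by fact
  show ?thesis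
    using one_absorbing_imp_classical classical_imp_residual_one_absorbing
      residual_one_absorbing_imp_one_absorbing[OF assms(5-7)]
    by blast
qed

end
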